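(* For $\rho>0$ and $x\in\mathbb{R}^n_\downarrow$, let $w^\star$ be the optimal solution to the optimization problem $$\min\left\{-\frac{\rho}{2}\langle x,w\rangle^2+h_2(w): w\in\mathbb{S}^{n-1}_+\right\}.$$ If $x_n\le\frac{\underline\alpha}{\rho\|x\|_1}$, where $$\underline\alpha:=\left(\frac{\rho}{2}\|x\|_2^2+n\right)-\sqrt{\left(\frac{\rho}{2}\|x\|_2^2+n\right)^2-2\rho\|x\|_1^2},$$ then $(w^\star)_n=0$.
   Context: $\mathbb{R}^n_\downarrow=\{x\in\mathbb{R}^n:x_1\ge x_2\ge\dots\ge x_n\ge0\}$. $\mathbb{S}^{n-1}_+$ is the set of vectors in $\mathbb{R}^n$ of Euclidean norm $1$ with nonnegative entries. The function $h_2$ is defined by $h_2(u)=(\|u\|_1/\|u\|_2)^2$ for $u\ne0$ and $h_2(0)=0$; for $w\in\mathbb{S}^{n-1}_+$ the objective above equals $\frac12 w^\top(2ee^\top-\rho xx^\top)w$, where $e\in\mathbb{R}^n$ is the all-ones vector. $(w^\star)_n$ denotes the last entry of $w^\star$.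
   Formalization: n ≥ 2 is assumed, since for n = 1 the claim fails (ρ = 1, x = 1 gives w* = 1); as minimizers need not be unique, the claim is that a unique optimal w* has last entry 0 and that some optimal w* with last entry 0 always exists. *)

theory Defs
  imports "HOL-Analysis.Analysis"
begin

text \<open>
  Coordinates are indexed by a finite linearly ordered type, so that \<open>n = CARD('n)\<close>,
  the order on the index type is the order of the coordinates, and the last index is its maximum.
\<close>

definition last_index :: "'n::{finite,linorder}" where
  "last_index = Max UNIV"

definition norm1 :: "real ^ 'n \<Rightarrow> real" where
  "norm1 u = (\<Sum>i\<in>UNIV. \<bar>u $ i\<bar>)"

definition h2 :: "real ^ 'n \<Rightarrow> real" where
  "h2 u = (if u = 0 then 0 else (norm1 u / norm u)\<^sup>2)"

definition down_cone :: "(real ^ 'n::{finite,linorder}) set" where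
  "down_cone = {x. (\<forall>i j. i \<le> j \<longrightarrow> x $ j \<le> x $ i) \<and> (\<forall>i. 0 \<le> x $ i)}"

definition nonneg_sphere :: "(real ^ 'n) set" where
  "nonneg_sphere = {w. norm w = 1 \<and> (\<forall>i. 0 \<le> w $ i)}"

definition objective :: "real \<Rightarrow> real ^ 'n \<Rightarrow> real ^ 'n \<Rightarrow> real" where
  "objective \<rho> x w = - (\<rho> / 2) * (x \<bullet> w)\<^sup>2 + h2 w"

definition optimal_solution :: "real \<Rightarrow> real ^ 'n \<Rightarrow> real ^ 'n \<Rightarrow> bool" where
  "optimal_solution \<rho> x w \<longleftrightarrow> is_arg_min (objective \<rho> x) (\<lambda>v. v \<in> nonneg_sphere) w"

definition alpha_lower :: "real \<Rightarrow> real ^ 'n \<Rightarrow> real" where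
  "alpha_lower \<rho> x =
     (\<rho> / 2 * (norm x)\<^sup>2 + real CARD('n))
       - sqrt ((\<rho> / 2 * (norm x)\<^sup>2 + real CARD('n))\<^sup>2 - 2 * \<rho> * (norm1 x)\<^sup>2)"

end

theory Submission
  imports Defs
begin

text \<open>
  Swapping a zero entry of a minimizer into the last position does not increase the objective, as
  \<open>x\<close> is smallest there. So suppose that a minimizer \<open>w\<close> with value \<open>m\<close> has only positive entries.
  Then the quadratic form of \<open>e e\<^sup>T - (\<rho>/2) x x\<^sup>T - m I\<close> is nonnegative around its zero \<open>w\<close>, so \<open>w\<close> is an
  eigenvector for \<open>m\<close> and the form is nonnegative everywhere; differences of unit vectors give
  \<open>m \<le> 0\<close>. If \<open>m = 0\<close>, then \<open>x\<close> is a multiple of \<open>e\<close> and the objective is constant. If \<open>m < 0\<close>,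
  positivity of the last entry of the eigenvector means \<open>\<rho> \<parallel>x\<parallel>\<^sub>1 x\<^sub>n > 2 m + \<rho> \<parallel>x\<parallel>\<^sup>2\<close>, and the right-hand
  side is a root of a quadratic polynomial whose smaller root is \<open>\<alpha>\<close>.
\<close>

text \<open>Taking \<open>t\<close> and \<open>- t\<close> together bounds
  \<open>\<bar>b\<bar>\<close> by \<open>t * c\<close> for small \<open>t > 0\<close>, and letting
  \<open>t\<close> tend to 0 kills \<open>b\<close>. This turns local minimality along a line into
  first and second order conditions.\<close>

lemma eventually_quadratic_nonneg:
  fixes b c :: real
  assumes "\<forall>\<^sub>F t in at 0. 0 \<le> t * b + t\<^sup>2 * c"
  shows "b = 0 \<and> 0 \<le> c"
proof -
  obtain d where d: "d > 0" "\<And>t. t \<noteq> 0 \<Longrightarrow> \<bar>t\<bar> < d \<Longrightarrow> 0 \<le> t * b + t\<^sup>2 * c"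
    using assms by (auto simp: eventually_at dist_real_def)
  have le: "\<bar>b\<bar> \<le> t * c" if "0 < t" "t < d" for t
  proof -
    have "0 \<le> t * (b + t * c)" "0 \<le> t * (- b + t * c)"
      using d(2)[of t] d(2)[of "- t"] that by (auto simp: algebra_simps power2_eq_square)
    then show ?thesis
      using that by (auto simp: zero_le_mult_iff)
  qed
  have "((\<lambda>t. t * c) \<longlongrightarrow> 0 * c) (at_right 0)"
    by (intro tendsto_intros)
  moreover have "\<forall>\<^sub>F t in at_right 0. \<bar>b\<bar> \<le> t * c"
    unfolding eventually_at_right_field using d(1) le by blast
  ultimately have "\<bar>b\<bar> \<le> 0"
    using tendsto_lowerbound[of "\<lambda>t. t * c" "0 * c" "at_right 0" "\<bar>b\<bar>"] by simp
  moreover have "0 \<le> d / 2 * c"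
    using le[of "d / 2"] d(1) by linarith
  ultimately show ?thesis
    using d(1) by (auto simp: zero_le_mult_iff)
qed

lemma norm1_eq_inner: "(\<And>i. 0 \<le> u $ i) \<Longrightarrow> norm1 u = vec 1 \<bullet> u"
  by (simp add: norm1_def inner_vec_def)

text \<open>On the sphere the denominator in \<open>h2\<close> is 1, and \<open>norm1\<close> is
  linear on nonnegative vectors. The objective thus becomes a quadratic form, with
  \<open>vec 1\<close> as the all-ones vector.\<close>

lemma objective_eq:
  assumes "w \<in> nonneg_sphere"
  shows "objective \<rho> x w = (vec 1 \<bullet> w)\<^sup>2 - \<rho> / 2 * (x \<bullet> w)\<^sup>2"
proof -
  have "norm w = 1" "w \<noteq> 0" "norm1 w = vec 1 \<bullet> w"
    using assms by (auto simp: nonneg_sphere_def norm1_eq_inner)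
  then show ?thesis
    by (simp add: objective_def h2_def)
qed

lemma axis_nth_neq: "i \<noteq> j \<Longrightarrow> axis i x $ j = 0"
  by (simp add: axis_def)

lemma axis_in_nonneg_sphere: "axis i 1 \<in> nonneg_sphere"
  by (simp add: nonneg_sphere_def) (simp add: axis_def)

lemma optimal_solution_iff:
  "optimal_solution \<rho> x w \<longleftrightarrow>
    w \<in> nonneg_sphere \<and> (\<forall>v\<in>nonneg_sphere. objective \<rho> x w \<le> objective \<rho> x v)"
  by (auto simp: optimal_solution_def is_arg_min_def not_less)

lemma optimal_solution_exists: "\<exists>w. optimal_solution \<rho> x (w :: real ^ 'n)"
proof -
  have "closed {w :: real ^ 'n. 0 \<le> w $ i}" for i
    by (intro closed_Collect_le continuous_intros)
  then have "compact (sphere 0 1 \<inter> (\<Inter>i. {w :: real ^ 'n. 0 \<le> w $ i}))"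
    by (simp add: compact_Int_closed closed_INT)
  also have "sphere 0 1 \<inter> (\<Inter>i. {w :: real ^ 'n. 0 \<le> w $ i}) = nonneg_sphere"
    by (auto simp: nonneg_sphere_def)
  finally have "compact (nonneg_sphere :: (real ^ 'n) set)" .
  moreover have "continuous_on nonneg_sphere
      (\<lambda>w :: real ^ 'n. (vec 1 \<bullet> w)\<^sup>2 - \<rho> / 2 * (x \<bullet> w)\<^sup>2)"
    by (intro continuous_intros)
  moreover have "(nonneg_sphere :: (real ^ 'n) set) \<noteq> {}"
    using axis_in_nonneg_sphere by blast
  ultimately have "\<exists>w\<in>nonneg_sphere. \<forall>v\<in>nonneg_sphere.
      (vec 1 \<bullet> w)\<^sup>2 - \<rho> / 2 * (x \<bullet> w)\<^sup>2 \<le> (vec 1 \<bullet> v)\<^sup>2 - \<rho> / 2 * (x \<bullet> v)\<^sup>2"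
    by (intro continuous_attains_inf)
  then show ?thesis
    by (auto simp: optimal_solution_iff objective_eq)
qed

lemma optimal_solution_last_zero_if_zero_entry:
  fixes x :: "real ^ 'n::{finite,linorder}"
  assumes "optimal_solution \<rho> x w" "w $ k = 0" "\<rho> > 0" "x \<in> down_cone"
  shows "\<exists>v. optimal_solution \<rho> x v \<and> v $ last_index = 0"
proof -
  let ?l = "last_index :: 'n"
  \<comment> \<open>As \<open>w $ k = 0\<close>, this exchanges the entries at \<open>k\<close> and
    \<open>?l\<close>; for \<open>k = ?l\<close> it is \<open>w\<close> itself.\<close>
  define v where "v = w + (w $ ?l) *\<^sub>R (axis k 1 - axis ?l 1)"
  have w: "w \<in> nonneg_sphere" "norm w = 1" "\<And>i. 0 \<le> w $ i" "\<And>i. 0 \<le> x $ i"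
    using assms by (auto simp: optimal_solution_iff nonneg_sphere_def down_cone_def)
  have vl: "v $ ?l = 0"
    using assms(2) by (auto simp: v_def axis_def)
  have vn: "0 \<le> v $ i" for i
    using w(3) by (auto simp: v_def axis_def)
  have "v \<bullet> v = w \<bullet> w"
  proof (cases "k = ?l")
    case False
    then show ?thesis
      using assms(2)
      by (simp add: v_def inner_add_left inner_add_right inner_diff_left inner_diff_right
          inner_axis inner_axis' axis_nth_neq)
  qed (simp add: v_def)
  then have v: "v \<in> nonneg_sphere"
    using vn w(2) by (simp add: nonneg_sphere_def norm_eq_sqrt_inner)
  have ev: "vec 1 \<bullet> v = vec 1 \<bullet> w"
    by (simp add: v_def algebra_simps inner_axis)
  have "k \<le> ?l"
    by (simp add: last_index_def)
  then have "x $ ?l \<le> x $ k"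
    using assms(4) by (auto simp: down_cone_def)
  then have "x \<bullet> w \<le> x \<bullet> v"
    using w(3)[of ?l] by (simp add: v_def inner_add_right inner_diff_right inner_axis)
  moreover have "0 \<le> x \<bullet> w"
    using w by (auto simp: inner_vec_def intro!: sum_nonneg)
  ultimately have "(x \<bullet> w)\<^sup>2 \<le> (x \<bullet> v)\<^sup>2"
    by simp
  then have "objective \<rho> x v \<le> objective \<rho> x w"
    using assms(3) ev by (simp add: objective_eq v w(1))
  then have "optimal_solution \<rho> x v"
    using assms(1) v unfolding optimal_solution_iff by fastforce
  with vl show ?thesis
    by blast
qed

text \<open>Positive vectors form an open set, so no sign constraint is active at \<open>w\<close>
  and lines through \<open>w\<close> in every direction \<open>u\<close> can be tested.\<close>

lemma positive_optimal_solution_stationary: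
  fixes x w :: "real ^ 'n"
  assumes "optimal_solution \<rho> x w" "\<And>i. 0 < w $ i"
  defines "m \<equiv> objective \<rho> x w"
  shows "2 * (vec 1 \<bullet> w) * (vec 1 \<bullet> u) - \<rho> * (x \<bullet> w) * (x \<bullet> u) = 2 * m * (w \<bullet> u)"
    and "0 \<le> (vec 1 \<bullet> u)\<^sup>2 - \<rho> / 2 * (x \<bullet> u)\<^sup>2 - m * (u \<bullet> u)"
proof -
  \<comment> \<open>The term with \<open>m\<close> makes \<open>p\<close> homogeneous of degree two,
    so normalizing a positive vector does not change the sign of \<open>p\<close>.\<close>
  define p where "p v = (vec 1 \<bullet> v)\<^sup>2 - \<rho> / 2 * (x \<bullet> v)\<^sup>2 - m * (v \<bullet> v)" for v :: "real ^ 'n"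
  have w: "w \<in> nonneg_sphere" "w \<bullet> w = 1"
    using assms(1) by (auto simp: optimal_solution_iff nonneg_sphere_def dot_square_norm)
  have pw: "p w = 0"
    using objective_eq[OF w(1), of \<rho> x] w(2) by (simp add: p_def m_def)
  have pos: "0 \<le> p v" if "\<And>i. 0 < v $ i" for v
  proof -
    let ?v = "(1 / norm v) *\<^sub>R v"
    have "v \<noteq> 0"
      using that by fastforce
    then have v: "?v \<in> nonneg_sphere"
      using that by (auto simp: nonneg_sphere_def less_imp_le)
    then have "m \<le> (vec 1 \<bullet> ?v)\<^sup>2 - \<rho> / 2 * (x \<bullet> ?v)\<^sup>2"
      using assms(1) objective_eq[OF v, of \<rho> x] unfolding m_def optimal_solution_iff by metis
    also have "\<dots> = ((vec 1 \<bullet> v)\<^sup>2 - \<rho> / 2 * (x \<bullet> v)\<^sup>2) / (norm v)\<^sup>2"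
      by (simp add: power_divide diff_divide_distrib)
    finally show ?thesis
      using \<open>v \<noteq> 0\<close> by (simp add: p_def dot_square_norm field_simps)
  qed
  have "\<forall>\<^sub>F t in at 0. 0 < (w + t *\<^sub>R u) $ i" for i
  proof -
    have "((\<lambda>t. (w + t *\<^sub>R u) $ i) \<longlongrightarrow> (w + 0 *\<^sub>R u) $ i) (at 0)"
      by (intro tendsto_intros)
    then show ?thesis
      using assms(2)[of i] by (intro order_tendstoD) auto
  qed
  then have "\<forall>\<^sub>F t in at 0. \<forall>i. 0 < (w + t *\<^sub>R u) $ i"
    by (intro eventually_all_finite) auto
  then have "\<forall>\<^sub>F t in at 0. 0 \<le> p (w + t *\<^sub>R u)"
    by eventually_elim (auto intro: pos)
  \<comment> \<open>The linear coefficient is twice the polar form of \<open>p\<close> at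
    \<open>w\<close> and \<open>u\<close>; the constant term \<open>p w\<close> vanishes.\<close>
  moreover have "p (w + t *\<^sub>R u) = t * (2 * (vec 1 \<bullet> w) * (vec 1 \<bullet> u) - \<rho> * (x \<bullet> w) * (x \<bullet> u)
      - 2 * m * (w \<bullet> u)) + t\<^sup>2 * p u" for t
  proof -
    have "p (w + t *\<^sub>R u) = p w + t * (2 * (vec 1 \<bullet> w) * (vec 1 \<bullet> u) - \<rho> * (x \<bullet> w) * (x \<bullet> u)
      - 2 * m * (w \<bullet> u)) + t\<^sup>2 * p u"
      unfolding p_def
      by (simp add: inner_add_right inner_add_left inner_commute[of u w] power2_eq_square)
        (simp add: field_simps)
    then show ?thesis
      using pw by simp
  qed
  ultimately have "2 * (vec 1 \<bullet> w) * (vec 1 \<bullet> u) - \<rho> * (x \<bullet> w) * (x \<bullet> u) - 2 * m * (w \<bullet> u) = 0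
      \<and> 0 \<le> p u"
    by (intro eventually_quadratic_nonneg) simp
  then show "2 * (vec 1 \<bullet> w) * (vec 1 \<bullet> u) - \<rho> * (x \<bullet> w) * (x \<bullet> u) = 2 * m * (w \<bullet> u)"
    "0 \<le> (vec 1 \<bullet> u)\<^sup>2 - \<rho> / 2 * (x \<bullet> u)\<^sup>2 - m * (u \<bullet> u)"
    by (auto simp: p_def)
qed

text \<open>This degenerate case does occur: if all entries of \<open>x\<close> equal
  \<open>c > 0\<close> with \<open>\<rho> * c\<^sup>2 = 2\<close>, the bound on the last entry holds
  with equality.\<close>

lemma positive_optimal_solution_objective_zero:
  fixes x :: "real ^ 'n::{finite,linorder}"
  assumes "CARD('n) \<ge> 2" "\<rho> > 0" "x \<in> down_cone"
    and "x $ last_index \<le> alpha_lower \<rho> x / (\<rho> * norm1 x)"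
    and opt: "optimal_solution \<rho> x w" and pos: "\<And>i. 0 < w $ i"
  shows "v \<in> nonneg_sphere \<Longrightarrow> objective \<rho> x v = 0"
proof -
  define m s t X N where defs: "m = objective \<rho> x w" "s = vec 1 \<bullet> w" "t = x \<bullet> w"
    "X = norm1 x" "N = (norm x)\<^sup>2"
  note stat = positive_optimal_solution_stationary[OF opt pos, folded defs]
  have x: "0 \<le> x $ i" for i
    using assms(3) by (auto simp: down_cone_def)
  have X: "vec 1 \<bullet> x = X" "x \<bullet> vec 1 = X" "x \<bullet> x = N"
    using x by (auto simp: norm1_eq_inner defs inner_commute dot_square_norm)
  have comp: "2 * s - \<rho> * t * x $ i = 2 * m * w $ i" for i
    using stat(1)[of "axis i 1"] by (simp add: inner_axis)
  \<comment> \<open>Pairing the eigenvector equation with \<open>x\<close>, and below with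
    \<open>vec 1\<close>, gives a closed linear system in \<open>s\<close> and
    \<open>t\<close>.\<close>
  have eqx: "2 * s * X - \<rho> * t * N = 2 * m * t"
    using stat(1)[of x] X by (simp add: defs inner_commute)
  have "vec 1 \<bullet> (vec 1 :: real ^ 'n::{finite,linorder}) = CARD('n)"
    by (simp add: inner_vec_def)
  then have eqe: "2 * s * CARD('n) - \<rho> * t * X = 2 * m * s"
    using stat(1)[of "vec 1"] X by (simp add: defs inner_commute)
  have s: "s > 0"
    using pos by (auto simp: defs inner_vec_def intro!: sum_pos)
  \<comment> \<open>The difference of two unit vectors is orthogonal to \<open>vec 1\<close>, so
    only nonpositive terms and \<open>- m * 2\<close> remain in the form.\<close>
  obtain i j :: 'n where "i \<noteq> j"
    using assms(1) card_le_Suc0_iff_eq[of "UNIV :: 'n set"] by fastforce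
  then have "0 \<le> - (\<rho> / 2 * (x $ i - x $ j)\<^sup>2) - m * 2"
    using stat(2)[of "axis i 1 - axis j 1"]
    by (simp add: inner_diff_right inner_diff_left inner_axis axis_nth_neq)
  moreover have "0 \<le> \<rho> / 2 * (x $ i - x $ j)\<^sup>2"
    using assms(2) by simp
  ultimately have m: "m \<le> 0"
    by linarith
  \<comment> \<open>If \<open>t = 0\<close>, then \<open>comp\<close> would give
    \<open>s = m * w $ i \<le> 0\<close>.\<close>
  have "t \<noteq> 0"
    using comp[of i] s mult_nonpos_nonneg[OF m less_imp_le[OF pos[of i]]] by auto
  moreover have "0 \<le> t"
    using x less_imp_le[OF pos] by (auto simp: defs inner_vec_def intro!: sum_nonneg)
  ultimately have t: "t > 0"
    by simp
  have "X \<ge> 0"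
    by (auto simp: defs norm1_def intro!: sum_nonneg)
  moreover have "X \<noteq> 0"
  proof
    assume "X = 0"
    then have "x = 0"
      by (auto simp: defs norm1_def sum_nonneg_eq_0_iff vec_eq_iff)
    with t show False
      by (simp add: defs)
  qed
  ultimately have Xpos: "X > 0"
    by simp
  have "m = 0"
  proof (rule ccontr)
    assume "m \<noteq> 0"
    then have "m * w $ last_index < 0"
      using m pos by (simp add: mult_neg_pos)
    then have "2 * s < \<rho> * t * x $ last_index"
      using comp[of last_index] by linarith
    then have "2 * s * X < \<rho> * t * x $ last_index * X"
      using Xpos by simp
    then have "t * (2 * m + \<rho> * N) < t * (\<rho> * x $ last_index * X)"
      using eqx by (simp add: algebra_simps)
    then have lt: "2 * m + \<rho> * N < \<rho> * X * x $ last_index"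
      using t by (simp add: mult.assoc mult.commute[of X])
    define A where "A = \<rho> / 2 * N + CARD('n)"
    \<comment> \<open>Eliminating \<open>s\<close> shows that \<open>z = 2 * m + \<rho> * N\<close>
      solves \<open>z * (2 * A - z) = 2 * \<rho> * X\<^sup>2\<close>. The discriminant is then the
      square of \<open>A - z\<close>, so \<open>z\<close> is at least the smaller root.\<close>
    have "t * ((2 * m + \<rho> * N) * (2 * CARD('n) - 2 * m)) = t * (2 * \<rho> * X\<^sup>2)"
    proof -
      have "t * ((2 * m + \<rho> * N) * (2 * CARD('n) - 2 * m)) = 2 * s * X * (2 * CARD('n) - 2 * m)"
        using eqx by (simp add: algebra_simps)
      also have "\<dots> = 2 * X * (2 * s * CARD('n) - 2 * m * s)"
        by (simp add: algebra_simps)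
      also have "2 * s * CARD('n) - 2 * m * s = \<rho> * t * X"
        using eqe by simp
      finally show ?thesis
        by (simp add: power2_eq_square mult.commute mult.left_commute)
    qed
    then have "(2 * m + \<rho> * N) * (2 * CARD('n) - 2 * m) = 2 * \<rho> * X\<^sup>2"
      using t by simp
    then have "A\<^sup>2 - 2 * \<rho> * X\<^sup>2 = (A - (2 * m + \<rho> * N))\<^sup>2"
      by (simp add: A_def power2_eq_square field_simps)
    then have "A - sqrt (A\<^sup>2 - 2 * \<rho> * X\<^sup>2) \<le> 2 * m + \<rho> * N"
      by simp
    then have "alpha_lower \<rho> x < \<rho> * X * x $ last_index"
      using lt by (simp add: alpha_lower_def A_def defs)
    then show False
      using assms(2,4) Xpos by (simp add: defs field_simps)
  qed
  \<comment> \<open>With \<open>m = 0\<close>, \<open>comp\<close> forces every entry of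
    \<open>x\<close> to be this \<open>c\<close>. Then \<open>t = c * s\<close> yields
    \<open>\<rho> * c\<^sup>2 = 2\<close>, and the two squares in the objective cancel.\<close>
  define c where "c = 2 * s / (\<rho> * t)"
  have xc: "x = c *\<^sub>R vec 1"
    using comp \<open>m = 0\<close> t assms(2) by (simp add: vec_eq_iff c_def field_simps)
  have "t = c * s"
    by (simp add: defs(3) xc) (simp add: defs)
  then have "\<rho> * c\<^sup>2 = 2"
    using s t assms(2) by (simp add: c_def power2_eq_square field_simps)
  then show "v \<in> nonneg_sphere \<Longrightarrow> objective \<rho> x v = 0"
    by (simp add: objective_eq xc power_mult_distrib)
qed

text \<open>Optimal solutions need not be unique: at \<open>x = 0\<close>, where the quotient in the
  bound is 0 by convention, every \<open>axis k 1\<close> is optimal. Hence the two readings of "the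
  optimal solution" in the conclusion.\<close>

theorem theorem3p7:
  fixes \<rho> :: real and x :: "real ^ 'n::{finite,linorder}"
  assumes "CARD('n) \<ge> 2"
    and "\<rho> > 0"
    and "x \<in> down_cone"
    and "x $ last_index \<le> alpha_lower \<rho> x / (\<rho> * norm1 x)"
  shows "(\<forall>w. optimal_solution \<rho> x w \<and> (\<forall>v. optimal_solution \<rho> x v \<longrightarrow> v = w)
              \<longrightarrow> w $ last_index = 0)
       \<and> (\<exists>w. optimal_solution \<rho> x w \<and> w $ last_index = 0)"
proof -
  obtain w where w: "optimal_solution \<rho> x w"
    using optimal_solution_exists by blast
  have "\<exists>w. optimal_solution \<rho> x w \<and> w $ last_index = 0"
  proof (cases "\<exists>k. w $ k = 0")
    case True
    then show ?thesis
      using optimal_solution_last_zero_if_zero_entry[OF w] assms by blast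
  next
    case False
    have "0 \<le> w $ i" for i
      using w by (simp add: optimal_solution_iff nonneg_sphere_def)
    then have "0 < w $ i" for i
      using False by (simp add: less_le)
    then have zero: "objective \<rho> x v = 0" if "v \<in> nonneg_sphere" for v
      using positive_optimal_solution_objective_zero[OF assms w] that by blast
    \<comment> \<open>A constant objective makes every feasible vector optimal, so a unit vector
      along another coordinate serves as witness.\<close>
    obtain i j :: 'n where "i \<noteq> j"
      using assms(1) card_le_Suc0_iff_eq[of "UNIV :: 'n set"] by fastforce
    then obtain k :: 'n where "k \<noteq> last_index"
      by metis
    then have "optimal_solution \<rho> x (axis k 1) \<and> axis k (1::real) $ last_index = 0"
      by (auto simp: optimal_solution_iff axis_in_nonneg_sphere zero axis_nth_neq)
    then show ?thesis
      by blast
  qed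
  then show ?thesis
    by metis
qed

end
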